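(* Let $s\ge 1$ be an integer and let $\mathbf{A}_1,\dots,\mathbf{A}_s\in\mathbb{C}^{2\times 2}$ with $\mathbf{A}_t=\begin{pmatrix}\alpha_{1,1}^{(t)}&\alpha_{1,2}^{(t)}\\ \alpha_{2,1}^{(t)}&\alpha_{2,2}^{(t)}\end{pmatrix}$. Let $(a_n)_{n\ge0}$, $(b_n)_{n\ge0}$ be complex sequences with arbitrary initial values $a_0,\dots,a_{s-1},b_0,\dots,b_{s-1}$, satisfying for all $n\ge s$ \[ \begin{pmatrix}a_n\\ b_n\end{pmatrix}=\sum_{t=1}^{s}\mathbf{A}_t\begin{pmatrix}a_{n-t}\\ b_{n-t}\end{pmatrix}, \] i.e. $a_n=\sum_{t=1}^s(\alpha_{1,1}^{(t)}a_{n-t}+\alpha_{1,2}^{(t)}b_{n-t})$ and $b_n=\sum_{t=1}^s(\alpha_{2,1}^{(t)}a_{n-t}+\alpha_{2,2}^{(t)}b_{n-t})$. Define vectors $\mathbf{c}^{(r)}=(c^{(r)}_1,\dots,c^{(r)}_{2r})^T\in\mathbb{C}^{2r}$ for $r=1,\dots,s$ recursively by \[ \mathbf{c}^{(1)}=\begin{pmatrix}\operatorname{tr}(\mathbf{A}_1)\\ -|\mathbf{A}_1|\end{pmatrix}, \] and, for $2\le r\le s$, \[ \mathbf{c}^{(r)}= \begin{pmatrix}\mathbf{c}^{(r-1)}\\0\\0\end{pmatrix}+ \begin{pmatrix} 0\\ \vdots\\ 0\\ \operatorname{tr}(\mathbf{A}_{r})\\ -\mathcal{D}(\mathbf{A}^{(1,r)})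 \\ \vdots\\ -\mathcal{D}(\mathbf{A}^{(r-1,r)}) \\ 0 \end{pmatrix}+ \begin{pmatrix} 0\\ \vdots\\ 0 \\ -|\mathbf{A}_{r}| \end{pmatrix}, \] where in the second vector the entry $\operatorname{tr}(\mathbf{A}_r)$ is in position $r$, the entry $-\mathcal{D}(\mathbf{A}^{(\ell,r)})$ is in position $r+\ell$ for $\ell=1,\dots,r-1$, and all other entries (including position $2r$) are $0$; and in the third vector the only nonzero entry is $-|\mathbf{A}_r|$ in position $2r$. Equivalently, $c^{(r)}_i=c^{(r-1)}_i+\delta_{i,r}\operatorname{tr}(\mathbf{A}_r)-\sum_{\ell=1}^{r-1}\delta_{i,r+\ell}\,\mathcal{D}(\mathbf{A}^{(\ell,r)})-\delta_{i,2r}|\mathbf{A}_r|$ for $1\le i\le 2r$, with the convention $c^{(r-1)}_{2r-1}=c^{(r-1)}_{2r}=0$. Then both sequences $(a_n)$ and $(b_n)$ satisfy the homogeneous linear recurrence of order $2s$ \[ z_n=\sum_{i=1}^{2s}c^{(s)}_i z_{n-i},\qquad n\ge 2s. \]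
   Context: For a $2\times2$ matrix $\mathbf{A}$, $|\mathbf{A}|$ denotes its determinant and $\operatorname{tr}(\mathbf{A})$ its trace. For $1\le i,j\le s$, $\mathbf{A}_{i,j}$ denotes the $2\times 2$ matrix whose first column is the first column of $\mathbf{A}_i$ and whose second column is the second column of $\mathbf{A}_j$, i.e. $\mathbf{A}_{i,j}=\begin{pmatrix}\alpha_{1,1}^{(i)}&\alpha_{1,2}^{(j)}\\ \alpha_{2,1}^{(i)}&\alpha_{2,2}^{(j)}\end{pmatrix}$, and $\mathcal{D}(\mathbf{A}^{(i,j)}):=|\mathbf{A}_{i,j}|+|\mathbf{A}_{j,i}|$ (so $\mathcal{D}(\mathbf{A}^{(i,j)})=\mathcal{D}(\mathbf{A}^{(j,i)})$ and $\mathcal{D}(\mathbf{A}^{(i,i)})=2|\mathbf{A}_i|$). Note that $\mathbf{c}^{(r)}$ depends only on $\mathbf{A}_1,\dots,\mathbf{A}_r$. *)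

theory Defs
  imports "HOL-Analysis.Analysis"
begin

definition mixed_matrix :: "(nat \<Rightarrow> complex^2^2) \<Rightarrow> nat \<Rightarrow> nat \<Rightarrow> complex^2^2" where
  "mixed_matrix A i j = (\<chi> p q. if q = 1 then A i $ p $ q else A j $ p $ q)"

definition mixed_det :: "(nat \<Rightarrow> complex^2^2) \<Rightarrow> nat \<Rightarrow> nat \<Rightarrow> complex" where
  "mixed_det A i j = det (mixed_matrix A i j) + det (mixed_matrix A j i)"

(* A vector in C^(2r) is encoded as a function on nat: position i (counted from 1, as in the
   mathematical notation) holds the i-th entry, and every position outside {1..2*r} holds 0.
   Padding c^(r-1) with two zero entries therefore needs no explicit operation. *)

(* The entries tr(A_r), -D(A^(1,r)), ..., -D(A^(r-1,r)) in positions r, r+1, ..., 2r-1. *)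
definition trace_mixed_vec :: "(nat \<Rightarrow> complex^2^2) \<Rightarrow> nat \<Rightarrow> nat \<Rightarrow> complex" where
  "trace_mixed_vec A r i =
     (if i = r then trace (A r)
      else if r < i \<and> i < 2 * r then - mixed_det A (i - r) r
      else 0)"

definition det_vec :: "(nat \<Rightarrow> complex^2^2) \<Rightarrow> nat \<Rightarrow> nat \<Rightarrow> complex" where
  "det_vec A r i = (if i = 2 * r then - det (A r) else 0)"

(* The vectors c^(r) start at r = 1; the equation for r = 0 only makes the function total. *)
fun coeff_vec :: "(nat \<Rightarrow> complex^2^2) \<Rightarrow> nat \<Rightarrow> nat \<Rightarrow> complex" where
  "coeff_vec A 0 = (\<lambda>i. 0)"
| "coeff_vec A (Suc 0) =
     (\<lambda>i. if i = 1 then trace (A 1) else if i = 2 then - det (A 1) else 0)"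
| "coeff_vec A (Suc (Suc k)) =
     (\<lambda>i. coeff_vec A (Suc k) i + trace_mixed_vec A (Suc (Suc k)) i + det_vec A (Suc (Suc k)) i)"

end

(* In terms of the backward shift S, the system reads P(S) (a, b)^T = 0 with the polynomial matrix
   P(S) = I - (A_1 S + ... + A_s S^s).  Multiplying by the adjugate of P(S) shows that both
   components are annihilated by det P(S), and the entries of c^(s) are, up to sign, the
   nonconstant coefficients of det P(S).  Each use of the recurrence is at an index n - t with
   t \<le> s, which is admissible because n \<ge> 2s. *)

theory Submission
  imports Defs
begin

lemma det_mixed_matrix:
  "det (mixed_matrix A i j) = A i $ 1 $ 1 * A j $ 2 $ 2 - A j $ 1 $ 2 * A i $ 2 $ 1"
  by (simp add: det_2 mixed_matrix_def)

lemma mixed_matrix_same [simp]: "mixed_matrix A i i = A i"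
  by (simp add: mixed_matrix_def vec_eq_iff)

lemma coeff_vec_beyond: "r \<ge> 1 \<Longrightarrow> i > 2 * r \<Longrightarrow> coeff_vec A r i = 0"
  by (induction A r arbitrary: i rule: coeff_vec.induct)
     (auto simp: trace_mixed_vec_def det_vec_def)

lemma sum_det_vec:
  assumes "r \<ge> 1"
  shows "(\<Sum>i=1..2 * r. det_vec A r i * g i) = - det (A r) * g (2 * r)"
proof -
  have "(\<Sum>i=1..2 * r. det_vec A r i * g i)
      = (\<Sum>i=1..2 * r. if i = 2 * r then - det (A r) * g i else 0)"
    by (intro sum.cong) (auto simp: det_vec_def)
  also have "\<dots> = - det (A r) * g (2 * r)"
    using assms by (subst sum.delta) auto
  finally show ?thesis .
qed

lemma sum_trace_mixed_vec:
  "(\<Sum>i=1..2 * Suc r. trace_mixed_vec A (Suc r) i * g i)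
     = trace (A (Suc r)) * g (Suc r) - (\<Sum>l=1..r. mixed_det A l (Suc r) * g (Suc r + l))"
proof -
  let ?f = "\<lambda>i. trace_mixed_vec A (Suc r) i * g i"
  \<comment> \<open>The last position \<open>2 * Suc r\<close> drops out here: it belongs to
    \<open>det_vec\<close>.\<close>
  have "sum ?f {1..2 * Suc r} = sum ?f {Suc r..Suc r + r}"
    by (rule sum.mono_neutral_right) (auto simp: trace_mixed_vec_def)
  also have "\<dots> = ?f (Suc r) + sum ?f {1 + Suc r..r + Suc r}"
    by (subst sum.atLeast_Suc_atMost) (simp_all add: add.commute)
  also have "sum ?f {1 + Suc r..r + Suc r} = (\<Sum>l=1..r. ?f (l + Suc r))"
    by (rule sum.shift_bounds_cl_nat_ivl)
  also have "\<dots> = - (\<Sum>l=1..r. mixed_det A l (Suc r) * g (Suc r + l))"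
    unfolding sum_negf [symmetric]
    by (intro sum.cong) (auto simp: trace_mixed_vec_def add_ac)
  finally show ?thesis
    by (simp add: trace_mixed_vec_def)
qed

text \<open>Enlarging the square adds a border and a corner: the border pairs will form
  \<open>mixed_det\<close>, the corner the entry of \<open>det_vec\<close>.\<close>

lemma sum_square_Suc:
  fixes f :: "nat \<Rightarrow> nat \<Rightarrow> 'a::comm_monoid_add"
  shows "(\<Sum>i=1..Suc r. \<Sum>j=1..Suc r. f i j)
     = (\<Sum>i=1..r. \<Sum>j=1..r. f i j) + (\<Sum>l=1..r. f l (Suc r) + f (Suc r) l) + f (Suc r) (Suc r)"
  by (simp add: sum.distrib add_ac)

text \<open>Unrolls the recursion for \<open>coeff_vec\<close>. With g i = X^i the right side is 1 -
  det(I - (A_1 X + ... + A_s X^s)); keeping \<open>g\<close> arbitrary lets it be read as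
  \<open>a (n - i)\<close> or \<open>b (n - i)\<close>.\<close>

lemma sum_coeff_vec:
  assumes "s \<ge> 1"
  shows "(\<Sum>i=1..2 * s. coeff_vec A s i * g i)
     = (\<Sum>t=1..s. trace (A t) * g t)
       - (\<Sum>i=1..s. \<Sum>j=1..s. det (mixed_matrix A i j) * g (i + j))"
  using assms
proof (induction s rule: nat_induct_at_least)
  case base
  show ?case
    by (simp add: numeral_2_eq_2)
next
  case (Suc r)
  let ?c = "coeff_vec A"
  \<comment> \<open>The general equation of \<open>coeff_vec\<close> only matches indices of the
    form \<open>Suc (Suc k)\<close>.\<close>
  obtain k where k: "r = Suc k"
    using Suc.hyps by (cases r) auto
  have "(\<Sum>i=1..2 * Suc r. ?c (Suc r) i * g i)
      = (\<Sum>i=1..2 * Suc r. ?c r i * g i)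
        + (\<Sum>i=1..2 * Suc r. trace_mixed_vec A (Suc r) i * g i)
        + (\<Sum>i=1..2 * Suc r. det_vec A (Suc r) i * g i)"
    by (simp only: k coeff_vec.simps distrib_right sum.distrib)
  \<comment> \<open>The two padding entries are zero.\<close>
  also have "(\<Sum>i=1..2 * Suc r. ?c r i * g i) = (\<Sum>i=1..2 * r. ?c r i * g i)"
    using Suc.hyps by (intro sum.mono_neutral_right) (auto simp: coeff_vec_beyond)
  finally show ?case
    unfolding Suc.IH sum_trace_mixed_vec sum_square_Suc
    by (subst (asm) sum_det_vec)
       (simp_all add: mixed_det_def algebra_simps sum.distrib mult_2 mult_2_right)
qed

text \<open>This is the first row of the adjugate identity in scalar form: the recurrence for
  \<open>x\<close> is applied inside the \<open>v\<close>-weighted sum of \<open>x\<close>, that for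
  \<open>y\<close> inside the \<open>q\<close>-weighted sum of \<open>y\<close>, and the difference
  is free of \<open>y\<close>. Generic coefficients allow exchanging the two sequences.\<close>

lemma eliminate_second_sequence:
  fixes p q u v :: "nat \<Rightarrow> 'a::comm_ring" and x y :: "nat \<Rightarrow> 'a"
  assumes x: "\<And>n. n \<ge> s \<Longrightarrow> x n = (\<Sum>t=1..s. p t * x (n - t) + q t * y (n - t))"
    and y: "\<And>n. n \<ge> s \<Longrightarrow> y n = (\<Sum>t=1..s. u t * x (n - t) + v t * y (n - t))"
    and n: "n \<ge> 2 * s"
  shows "x n = (\<Sum>t=1..s. (p t + v t) * x (n - t))
     - (\<Sum>i=1..s. \<Sum>j=1..s. (p i * v j - q j * u i) * x (n - (i + j)))"
proof -
  have vx: "(\<Sum>j=1..s. v j * x (n - j))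
      = (\<Sum>j=1..s. \<Sum>i=1..s. p i * v j * x (n - (i + j)))
        + (\<Sum>j=1..s. \<Sum>i=1..s. q i * v j * y (n - (i + j)))"
    unfolding sum.distrib [symmetric]
    by (intro sum.cong refl) (subst x, use n in \<open>auto simp: sum_distrib_left algebra_simps\<close>)
  have qy: "(\<Sum>j=1..s. q j * y (n - j))
      = (\<Sum>j=1..s. \<Sum>i=1..s. q j * u i * x (n - (i + j)))
        + (\<Sum>j=1..s. \<Sum>i=1..s. q j * v i * y (n - (i + j)))"
    unfolding sum.distrib [symmetric]
    by (intro sum.cong refl) (subst y, use n in \<open>auto simp: sum_distrib_left algebra_simps\<close>)
  \<comment> \<open>The cancellation of \<open>y\<close>: the shift i + j is symmetric, so the
    operators with coefficients \<open>q\<close> and \<open>v\<close> commute.\<close>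
  have swap: "(\<Sum>j=1..s. \<Sum>i=1..s. q j * v i * y (n - (i + j)))
      = (\<Sum>j=1..s. \<Sum>i=1..s. q i * v j * y (n - (i + j)))"
    by (subst sum.swap) (simp add: add.commute)
  have split: "(\<Sum>i=1..s. \<Sum>j=1..s. (p i * v j - q j * u i) * x (n - (i + j)))
      = (\<Sum>j=1..s. \<Sum>i=1..s. p i * v j * x (n - (i + j)))
        - (\<Sum>j=1..s. \<Sum>i=1..s. q j * u i * x (n - (i + j)))"
    by (subst sum.swap) (simp add: left_diff_distrib sum_subtractf)
  have "x n = (\<Sum>t=1..s. p t * x (n - t)) + (\<Sum>t=1..s. q t * y (n - t))"
    using n by (simp add: x sum.distrib)
  then show ?thesis
    unfolding split distrib_right sum.distrib vx qy swap by (simp add: algebra_simps)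
qed

theorem theorem1:
  fixes s :: nat
    and A :: "nat \<Rightarrow> complex^2^2"
    and a b :: "nat \<Rightarrow> complex"
  assumes "s \<ge> 1"
    and "\<And>n. n \<ge> s \<Longrightarrow>
      (vector [a n, b n] :: complex^2) = (\<Sum>t=1..s. A t *v vector [a (n - t), b (n - t)])"
  shows "(\<forall>n\<ge>2 * s. a n = (\<Sum>i=1..2 * s. coeff_vec A s i * a (n - i))) \<and>
         (\<forall>n\<ge>2 * s. b n = (\<Sum>i=1..2 * s. coeff_vec A s i * b (n - i)))"
proof -
  have a: "a n = (\<Sum>t=1..s. A t $ 1 $ 1 * a (n - t) + A t $ 1 $ 2 * b (n - t))"
    if "n \<ge> s" for n
    using arg_cong [OF assms(2) [OF that], of "\<lambda>w. w $ 1"]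
    by (simp add: matrix_vector_mult_def sum_2)
  have b: "b n = (\<Sum>t=1..s. A t $ 2 $ 1 * a (n - t) + A t $ 2 $ 2 * b (n - t))"
    if "n \<ge> s" for n
    using arg_cong [OF assms(2) [OF that], of "\<lambda>w. w $ 2"]
    by (simp add: matrix_vector_mult_def sum_2)
  \<comment> \<open>With \<open>p\<close>, \<open>q\<close>, \<open>u\<close>, \<open>v\<close> the
    entries 11, 12, 21, 22, the products in the elimination are literally the mixed
    determinants.\<close>
  have "a n = (\<Sum>i=1..2 * s. coeff_vec A s i * a (n - i))" if "n \<ge> 2 * s" for n
    unfolding sum_coeff_vec [OF assms(1)] det_mixed_matrix trace_def sum_2
    by (rule eliminate_second_sequence [OF a b that])
  moreover have "b n = (\<Sum>i=1..2 * s. coeff_vec A s i * b (n - i))" if "n \<ge> 2 * s" for n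
  proof -
    \<comment> \<open>Exchanging the roles of \<open>a\<close> and \<open>b\<close> turns the (i, j)
      summand into the determinant of \<open>mixed_matrix A j i\<close>; the sum over the square is
      unaffected.\<close>
    have swap: "(\<Sum>i=1..s. \<Sum>j=1..s.
          (A i $ 2 $ 2 * A j $ 1 $ 1 - A j $ 2 $ 1 * A i $ 1 $ 2) * b (n - (i + j)))
        = (\<Sum>i=1..s. \<Sum>j=1..s. det (mixed_matrix A i j) * b (n - (i + j)))"
      by (subst sum.swap) (simp add: det_mixed_matrix add.commute mult.commute)
    have "b n = (\<Sum>t=1..s. (A t $ 2 $ 2 + A t $ 1 $ 1) * b (n - t))
        - (\<Sum>i=1..s. \<Sum>j=1..s.
          (A i $ 2 $ 2 * A j $ 1 $ 1 - A j $ 2 $ 1 * A i $ 1 $ 2) * b (n - (i + j)))"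
      by (rule eliminate_second_sequence [OF _ _ that]) (use a b in \<open>simp_all add: add.commute\<close>)
    then show ?thesis
      unfolding sum_coeff_vec [OF assms(1)] swap by (simp add: trace_def sum_2 add.commute)
  qed
  ultimately show ?thesis
    by blast
qed

end
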